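(* Consider a reversible-irreversible port-Hamiltonian system (RIPHS) on an open set $\mathbb X\subset\mathbb R^n$ with Hamiltonian $H$, entropy $S$ and structure matrices $J_1,\dots,J_N$. The set of thermodynamic equilibria $$\mathcal T=\{x\in\mathbb X:\{S,H\}_{J_k}(x)=0\text{ for all }k=1,\dots,N\}$$ is closed in $\mathbb X$. If $S(x)=e^\top x$ with some $e\in\mathbb R^n$ and for all $x\in\mathbb X$ we have $$\operatorname{rank}\begin{bmatrix}H_{xx}(x)\\ H_x(x)^\top\end{bmatrix}=n,$$ then $\mathcal T$ is a $C^1$-submanifold of $\mathbb X$. It is empty if and only if $H_x(\mathbb X)\cap\bigcap_{k=1}^N(J_ke)^\perp=\emptyset$. Otherwise, its dimension is given by $$\dim\mathcal T=n-\operatorname{rank}[J_1e\ \cdots\ J_Ne].$$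
   Context: Notation: $F_x$ and $F_{xx}$ are the gradient and Hessian of a scalar function $F$; for a skew-symmetric $J\in\mathbb R^{n\times n}$, $\{v,w\}_J(x):=v_x(x)^\top Jw_x(x)$; $v^\perp=\{w\in\mathbb R^n:w^\top v=0\}$. A reversible-irreversible port-Hamiltonian system (RIPHS) on an open set $\mathbb X\subset\mathbb R^n$ is given by: a locally Lipschitz map $J_0:\mathbb X\to\mathbb R^{n\times n}$ with skew-symmetric values; a differentiable Hamiltonian $H:\mathbb X\to\mathbb R$ with locally Lipschitz gradient $H_x$; a differentiable entropy $S:\mathbb X\to\mathbb R$ with locally Lipschitz gradient $S_x$ and $J_0(x)S_x(x)=0$ for all $x\in\mathbb X$; constant skew-symmetric matrices $J_1,\dots,J_N\in\mathbb R^{n\times n}$; functions $\gamma_1,\dots,\gamma_N:\mathbb R^{2n}\to\mathbb R$ such that $x\mapsto\gamma_k(x,H_x(x))$ is positive and locally Lipschitz on $\mathbb X$; a locally Lipschitz map $g:\mathbb R^{2n}\to\mathbb R^{n\times m}$; and the state equation $$\dot x=\Big(J_0(x)+\sum_{k=1}^N\gamma_k(x,H_x(x))\{S,H\}_{J_k}(x)\,J_k\Big)H_x(x)+g(x,H_x(x))u.$$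
   Formalization: In the part with S(x)=e^T x (submanifold, emptiness criterion, dimension), H is additionally assumed twice continuously differentiable on X; with only a locally Lipschitz gradient the Hessian may not exist, and with a merely pointwise Hessian T need not be a C^1-submanifold. *)

theory Defs
  imports "HOL-Analysis.Analysis"
begin

section \<open>Gradients, Hessians and Poisson-type brackets\<close>

definition grad :: "(real^'n \<Rightarrow> real) \<Rightarrow> real^'n \<Rightarrow> real^'n" where
  "grad F x = (\<chi> i. frechet_derivative F (at x) (axis i 1))"

lemma grad_GDERIV:
  fixes F :: "real^'n \<Rightarrow> real"
  assumes "F differentiable (at x)"
  shows "GDERIV F x :> grad F x"
proof -
  let ?D = "frechet_derivative F (at x)"
  have D: "(F has_derivative ?D) (at x)"
    using assms by (simp add: frechet_derivative_works)
  then have lin: "linear ?D"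
    by (rule has_derivative_linear)
  have "?D h = h \<bullet> grad F x" for h
  proof -
    have "?D h = ?D (\<Sum>i\<in>UNIV. (h $ i) *\<^sub>R axis i 1)"
      using basis_expansion[of h] by (simp add: scalar_mult_eq_scaleR)
    also have "\<dots> = (\<Sum>i\<in>UNIV. (h $ i) * ?D (axis i 1))"
      by (simp add: linear_sum[OF lin] linear_cmul[OF lin])
    also have "\<dots> = h \<bullet> grad F x"
      by (simp add: grad_def inner_vec_def)
    finally show ?thesis .
  qed
  then have "?D = (\<lambda>h. h \<bullet> grad F x)" by blast
  with D show ?thesis
    by (simp add: gderiv_def)
qed

definition hessian :: "(real^'n \<Rightarrow> real) \<Rightarrow> real^'n \<Rightarrow> real^'n^'n" where
  "hessian F x = jacobian (grad F) (at x)"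

definition bracket :: "real^'n^'n \<Rightarrow> (real^'n \<Rightarrow> real) \<Rightarrow> (real^'n \<Rightarrow> real) \<Rightarrow> real^'n \<Rightarrow> real" where
  "bracket J v w x = grad v x \<bullet> (J *v grad w x)"

definition skew_symmetric :: "real^'n^'n \<Rightarrow> bool" where
  "skew_symmetric A \<longleftrightarrow> transpose A = - A"


section \<open>Reversible-irreversible port-Hamiltonian systems\<close>

text \<open>The library notion \<open>local_lipschitz\<close> is for families of maps indexed by a time set;
  here it is applied to a family with a single member.\<close>

definition locally_lipschitz :: "'a::metric_space set \<Rightarrow> ('a \<Rightarrow> 'b::metric_space) \<Rightarrow> bool" where
  "locally_lipschitz X f \<longleftrightarrow> local_lipschitz {0::real} X (\<lambda>_. f)"

text \<open>\<open>\<real>\<^sup>2\<^sup>n\<close> is rendered as the product of two copies of \<open>\<real>\<^sup>n\<close>.  Maps on the open set \<open>X\<close> are total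
  functions, constrained only on \<open>X\<close>.  The irreversible structure matrices are \<open>J 1, \<dots>, J N\<close>.\<close>

definition riphs ::
  "(real^'n) set \<Rightarrow> (real^'n \<Rightarrow> real^'n^'n) \<Rightarrow> (real^'n \<Rightarrow> real) \<Rightarrow> (real^'n \<Rightarrow> real) \<Rightarrow> nat
    \<Rightarrow> (nat \<Rightarrow> real^'n^'n) \<Rightarrow> (nat \<Rightarrow> (real^'n) \<times> (real^'n) \<Rightarrow> real)
    \<Rightarrow> ((real^'n) \<times> (real^'n) \<Rightarrow> real^'m^'n) \<Rightarrow> bool"
where
  "riphs X J\<^sub>0 H S N J \<gamma> g \<longleftrightarrow>
     open X \<and>
     locally_lipschitz X J\<^sub>0 \<and> (\<forall>x\<in>X. skew_symmetric (J\<^sub>0 x)) \<and>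
     (\<forall>x\<in>X. H differentiable (at x)) \<and> locally_lipschitz X (grad H) \<and>
     (\<forall>x\<in>X. S differentiable (at x)) \<and> locally_lipschitz X (grad S) \<and>
     (\<forall>x\<in>X. J\<^sub>0 x *v grad S x = 0) \<and>
     (\<forall>k\<in>{1..N}. skew_symmetric (J k)) \<and>
     (\<forall>k\<in>{1..N}. (\<forall>x\<in>X. \<gamma> k (x, grad H x) > 0) \<and>
                  locally_lipschitz X (\<lambda>x. \<gamma> k (x, grad H x))) \<and>
     locally_lipschitz UNIV g"

text \<open>The state equation is \<open>x' = riphs_rhs J\<^sub>0 H S N J \<gamma> g x u\<close>.  It imposes no further condition on
  the data.\<close>

definition riphs_rhs ::
  "(real^'n \<Rightarrow> real^'n^'n) \<Rightarrow> (real^'n \<Rightarrow> real) \<Rightarrow> (real^'n \<Rightarrow> real) \<Rightarrow> nat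
    \<Rightarrow> (nat \<Rightarrow> real^'n^'n) \<Rightarrow> (nat \<Rightarrow> (real^'n) \<times> (real^'n) \<Rightarrow> real)
    \<Rightarrow> ((real^'n) \<times> (real^'n) \<Rightarrow> real^'m^'n) \<Rightarrow> real^'n \<Rightarrow> real^'m \<Rightarrow> real^'n"
where
  "riphs_rhs J\<^sub>0 H S N J \<gamma> g x u =
     (J\<^sub>0 x + (\<Sum>k=1..N. (\<gamma> k (x, grad H x) * bracket (J k) S H x) *\<^sub>R J k)) *v grad H x
     + g (x, grad H x) *v u"

definition thermodynamic_equilibria ::
  "(real^'n) set \<Rightarrow> (real^'n \<Rightarrow> real) \<Rightarrow> (real^'n \<Rightarrow> real) \<Rightarrow> nat \<Rightarrow> (nat \<Rightarrow> real^'n^'n) \<Rightarrow> (real^'n) set"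
where
  "thermodynamic_equilibria X H S N J = {x\<in>X. \<forall>k\<in>{1..N}. bracket (J k) S H x = 0}"


section \<open>Ranks\<close>

text \<open>The \<open>(n+1) \<times> n\<close> matrix obtained by appending the row \<open>v\<close> below \<open>A\<close>.\<close>

definition append_row :: "real^'n^'n \<Rightarrow> real^'n \<Rightarrow> real^'n^('n + unit)" where
  "append_row A v = (\<chi> i. case i of Inl j \<Rightarrow> A $ j | Inr _ \<Rightarrow> v)"

text \<open>The rank of the matrix \<open>[v 1 \<dots> v N]\<close>.  The number of columns is a natural number rather than a
  type, so this is the dimension of the column space; the lemma below identifies it with \<open>rank\<close>.\<close>

definition rank_of_columns :: "nat \<Rightarrow> (nat \<Rightarrow> real^'n) \<Rightarrow> nat" where
  "rank_of_columns N v = dim (v ` {1..N})"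

lemma rank_of_columns_eq_rank:
  fixes v :: "nat \<Rightarrow> real^'n" and f :: "'k::finite \<Rightarrow> nat"
  assumes "bij_betw f UNIV {1..N}"
  shows "rank_of_columns N v = rank (\<chi> i j. v (f j) $ i)"
proof -
  have "columns (\<chi> i j. v (f j) $ i) = v ` f ` UNIV"
    by (auto simp: columns_def column_def)
  also have "f ` UNIV = {1..N}"
    using assms by (simp add: bij_betw_def)
  finally show ?thesis
    by (simp add: rank_of_columns_def column_rank_def)
qed


section \<open>\<open>C\<^sup>1\<close> maps and \<open>C\<^sup>1\<close>-submanifolds\<close>

definition C1_on :: "'a::real_normed_vector set \<Rightarrow> ('a \<Rightarrow> 'b::real_normed_vector) \<Rightarrow> bool" where
  "C1_on U f \<longleftrightarrow>
     (\<exists>f' :: 'a \<Rightarrow> 'a \<Rightarrow>\<^sub>L 'b.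
        (\<forall>x\<in>U. (f has_derivative blinfun_apply (f' x)) (at x)) \<and> continuous_on U f')"

definition C1_diffeomorphism ::
  "'a::real_normed_vector set \<Rightarrow> 'b::real_normed_vector set \<Rightarrow> ('a \<Rightarrow> 'b) \<Rightarrow> bool" where
  "C1_diffeomorphism U V \<phi> \<longleftrightarrow>
     open U \<and> open V \<and> (\<exists>\<psi>. homeomorphism U V \<phi> \<psi> \<and> C1_on U \<phi> \<and> C1_on V \<psi>)"

text \<open>\<open>M\<close> is an (embedded) \<open>C\<^sup>1\<close>-submanifold of the open set \<open>X\<close>, of dimension \<open>d\<close>: around each of its
  points, \<open>M\<close> is straightened to a \<open>d\<close>-dimensional linear subspace by a \<open>C\<^sup>1\<close>-diffeomorphism between
  open sets.  The dimension \<open>d\<close> is unique unless \<open>M\<close> is empty; the empty set is a submanifold of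
  every dimension.\<close>

definition C1_submanifold :: "'a::euclidean_space set \<Rightarrow> nat \<Rightarrow> 'a set \<Rightarrow> bool" where
  "C1_submanifold X d M \<longleftrightarrow>
     M \<subseteq> X \<and>
     (\<forall>p\<in>M. \<exists>U V L. \<exists>\<phi> :: 'a \<Rightarrow> 'a.
        p \<in> U \<and> U \<subseteq> X \<and> C1_diffeomorphism U V \<phi> \<and>
        subspace L \<and> dim L = d \<and> \<phi> ` (U \<inter> M) = V \<inter> L)"

end

theory Submission
  imports Defs
begin

text \<open>For \<open>S x = e \<bullet> x\<close> the equilibria are the preimage under \<open>grad H\<close> of the orthogonal complement
  of \<open>R = span {J k e}\<close>.  The rank condition makes \<open>grad H\<close> transversal to it: if \<open>r \<in> R\<close> annihilates
  the range of the Hessian, then the Hessian, being symmetric, kills \<open>r\<close>; at an equilibrium also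
  \<open>grad H x \<bullet> r = 0\<close>, so \<open>r = 0\<close>.\<close>

section \<open>The inverse function theorem for \<open>C\<^sup>1\<close> maps\<close>

text \<open>The identity \<open>B y - B z = B y o (A z - A y) o B z\<close> bounds the change of the
  inverse by that of \<open>A\<close>, once \<open>norm (B y)\<close> is bounded near
  \<open>z\<close>. This supplies continuity of the derivative of a local inverse.\<close>

lemma continuous_on_blinfun_inverse:
  fixes A :: "'c::topological_space \<Rightarrow> 'a::real_normed_vector \<Rightarrow>\<^sub>L 'b::real_normed_vector"
    and B :: "'c \<Rightarrow> 'b \<Rightarrow>\<^sub>L 'a"
  assumes cont: "continuous_on S A"
    and AB: "\<And>y. y \<in> S \<Longrightarrow> A y o\<^sub>L B y = id_blinfun"
    and BA: "\<And>y. y \<in> S \<Longrightarrow> B y o\<^sub>L A y = id_blinfun"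
  shows "continuous_on S B"
  unfolding continuous_on_def
proof
  fix z assume z: "z \<in> S"
  let ?F = "at z within S"
  define d where "d y = norm (A z - A y)" for y
  let ?b = "norm (B z)"
  have lim: "(A \<longlongrightarrow> A z) ?F"
    using cont z by (simp add: continuous_on_def)
  have d0: "(d \<longlongrightarrow> 0) ?F"
    unfolding d_def using tendsto_norm[OF tendsto_diff[OF tendsto_const[of "A z"] lim]] by simp
  have "((\<lambda>y. d y * ?b) \<longlongrightarrow> 0) ?F"
    using tendsto_mult_left_zero[OF d0] .
  \<comment> \<open>The threshold 1/2 lets \<open>norm (B y)\<close> be absorbed:
    \<open>norm (B y) \<le> ?b + norm (B y) / 2\<close> yields the local bound
    \<open>2 * ?b\<close>.\<close>
  then have small: "\<forall>\<^sub>F y in ?F. d y * ?b < 1/2"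
    by (rule order_tendstoD) simp
  have diff: "B y - B z = B y o\<^sub>L ((A z - A y) o\<^sub>L B z)" if "y \<in> S" for y
  proof (rule blinfun_eqI)
    fix v
    have "blinfun_apply (A z) (blinfun_apply (B z) v) = v"
      using AB[OF z] by (metis blinfun_apply_blinfun_compose blinfun_apply_id_blinfun)
    moreover have "blinfun_apply (B y) (blinfun_apply (A y) w) = w" for w
      using BA[OF that] by (metis blinfun_apply_blinfun_compose blinfun_apply_id_blinfun)
    ultimately show "blinfun_apply (B y - B z) v = blinfun_apply (B y o\<^sub>L ((A z - A y) o\<^sub>L B z)) v"
      by (simp add: blinfun.diff_left blinfun.diff_right)
  qed
  have bound: "norm (B y - B z) \<le> norm (B y) * (d y * ?b)" if "y \<in> S" for y
    unfolding diff[OF that] d_def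
    by (meson mult_left_mono norm_blinfun_compose norm_ge_zero order_trans)
  have S: "\<forall>\<^sub>F y in ?F. y \<in> S"
    by (simp add: eventually_at_filter)
  have "\<forall>\<^sub>F y in ?F. norm (B y - B z) \<le> 2 * ?b * (d y * ?b)"
    using small S
  proof (rule eventually_elim2)
    fix y assume y: "d y * ?b < 1/2" "y \<in> S"
    have nn: "0 \<le> d y * ?b"
      by (simp add: d_def)
    have "norm (B y) \<le> ?b + norm (B y - B z)"
      by (metis add.commute diff_add_cancel norm_triangle_ineq)
    also have "\<dots> \<le> ?b + norm (B y) * (1/2)"
      using bound[OF y(2)] mult_left_mono[of "d y * ?b" "1/2" "norm (B y)"] y(1) by force
    finally have "norm (B y) \<le> 2 * ?b"
      by simp
    then show "norm (B y - B z) \<le> 2 * ?b * (d y * ?b)"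
      using bound[OF y(2)] mult_right_mono[OF _ nn] by (meson order_trans)
  qed
  moreover have "((\<lambda>y. 2 * ?b * (d y * ?b)) \<longlongrightarrow> 0) ?F"
    using tendsto_mult_right_zero[OF tendsto_mult_left_zero[OF d0]] .
  ultimately have "((\<lambda>y. B y - B z) \<longlongrightarrow> 0) ?F"
    by (rule Lim_null_comparison)
  then show "(B \<longlongrightarrow> B z) ?F"
    by (simp add: LIM_zero_iff)
qed

text \<open>\<open>inverse_function_theorem\<close> yields the local inverse and its derivative at
  each point. That this derivative varies continuously follows because it inverts
  \<open>f' (g y)\<close>, which is continuous in \<open>y\<close>.\<close>

lemma C1_diffeomorphism_locally:
  fixes f :: "'a::euclidean_space \<Rightarrow> 'a"
  assumes "open X" "p \<in> X"
    and der: "\<And>x. x \<in> X \<Longrightarrow> (f has_derivative blinfun_apply (f' x)) (at x)"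
    and cont: "continuous_on X f'"
    and inj: "inj (blinfun_apply (f' p))"
  obtains U V where "p \<in> U" "U \<subseteq> X" "C1_diffeomorphism U V f"
proof -
  \<comment> \<open>Injectivity gives a left inverse of \<open>f' p\<close>, which is the form of
    invertibility that \<open>inverse_function_theorem\<close> asks for.\<close>
  obtain h where h: "linear h" "\<And>x. h (blinfun_apply (f' p) x) = x"
    using linear_injective_left_inverse[OF _ inj] blinfun.bounded_linear_right bounded_linear.linear
    by (metis comp_apply id_apply)
  have "Blinfun h o\<^sub>L f' p = id_blinfun"
    by (rule blinfun_eqI) (simp add: bounded_linear_Blinfun_apply linear_conv_bounded_linear[symmetric] h)
  from inverse_function_theorem[OF \<open>open X\<close> der cont \<open>p \<in> X\<close> this]
  obtain U V g g' where U: "open U" "U \<subseteq> X" "p \<in> U" and V: "open V"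
    and hom: "homeomorphism U V f g"
    and g: "\<And>y. y \<in> V \<Longrightarrow> (g has_derivative (g' y)) (at y)"
    and g': "\<And>y. y \<in> V \<Longrightarrow> g' y = inv (blinfun_apply (f'(g y)))"
    and bij: "\<And>y. y \<in> V \<Longrightarrow> bij (blinfun_apply (f'(g y)))"
    by metis
  have app: "blinfun_apply (Blinfun (g' y)) = g' y" if "y \<in> V" for y
    by (rule bounded_linear_Blinfun_apply) (rule has_derivative_bounded_linear[OF g[OF that]])
  have gV: "g ` V = U" "continuous_on V g"
    using hom by (auto simp: homeomorphism_def)
  have "continuous_on V (\<lambda>y. Blinfun (g' y))"
  proof (rule continuous_on_blinfun_inverse[where A = "\<lambda>y. f' (g y)"])
    show "continuous_on V (\<lambda>y. f' (g y))"
      by (rule continuous_on_compose2[OF cont gV(2)]) (use gV U in auto)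
    show "f' (g y) o\<^sub>L Blinfun (g' y) = id_blinfun" if "y \<in> V" for y
      by (rule blinfun_eqI) (simp add: app[OF that], simp add: g'[OF that] bij[OF that] bij_is_surj surj_f_inv_f)
    show "Blinfun (g' y) o\<^sub>L f' (g y) = id_blinfun" if "y \<in> V" for y
      by (rule blinfun_eqI) (simp add: app[OF that], simp add: g'[OF that] bij[OF that] bij_is_inj)
  qed
  then have "C1_on V g"
    unfolding C1_on_def using g by (intro exI[of _ "\<lambda>y. Blinfun (g' y)"]) (simp add: app)
  moreover have "C1_on U f"
    unfolding C1_on_def using der cont U(2) by (metis continuous_on_subset subsetD)
  ultimately show ?thesis
    using U V hom that unfolding C1_diffeomorphism_def by blast
qed


section \<open>Preimages of subspaces under transversal maps\<close>

lemma orthogonal_comp_span: "(span B)\<^sup>\<bottom> = B\<^sup>\<bottom>"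
  proof
  show "(span B)\<^sup>\<bottom> \<subseteq> B\<^sup>\<bottom>"
    by (rule orthogonal_comp_anti_mono[OF span_superset])
  show "B\<^sup>\<bottom> \<subseteq> (span B)\<^sup>\<bottom>"
  proof
    fix x assume "x \<in> B\<^sup>\<bottom>"
    then have "orthogonal x y" if "y \<in> B" for y
      using that by (simp add: orthogonal_comp_def orthogonal_commute[of x])
    then have "orthogonal x y" if "y \<in> span B" for y
      using that by (rule orthogonal_to_span[rotated])
    then show "x \<in> (span B)\<^sup>\<bottom>"
      by (simp add: orthogonal_comp_def orthogonal_commute[of x])
  qed
qed

lemma orthogonal_comp_comp: "B\<^sup>\<bottom>\<^sup>\<bottom> = span B" for B :: "'a::euclidean_space set"
  using orthogonal_comp_self[of "span B"] by (simp add: orthogonal_comp_span)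

text \<open>\<open>P\<close> sums the components along an orthonormal basis of \<open>W\<close>.
  Then \<open>x - P x\<close> is orthogonal to \<open>W\<close>, and \<open>W\<close> meets its
  complement only in 0. Such a \<open>P\<close> turns membership in a subspace into a linear
  equation.\<close>

lemma orthogonal_projection_exists:
  fixes W :: "'a::euclidean_space set"
  assumes "subspace W"
  obtains P where "linear P" "\<And>x. P x \<in> W" "\<And>x. x \<in> W \<Longrightarrow> P x = x"
    "\<And>x. P x = 0 \<longleftrightarrow> x \<in> W\<^sup>\<bottom>"
proof -
  obtain B where B: "B \<subseteq> W" "pairwise orthogonal B" "\<And>x. x \<in> B \<Longrightarrow> norm x = 1"
    "independent B" "span B = W"
    using orthonormal_basis_subspace[OF assms] by metis
  have fin: "finite B"
    using B(4) by (rule independent_imp_finite)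
  define P where "P x = (\<Sum>b\<in>B. (b \<bullet> x) *\<^sub>R b)" for x
  have lin: "linear P"
    unfolding P_def
    by (intro linear_compose_sum ballI linearI) (simp_all add: inner_add_right scaleR_add_left)
  have PW: "P x \<in> W" for x
    unfolding P_def by (intro subspace_sum[OF assms] subspace_scale[OF assms]) (use B(1) in auto)
  have PB: "c \<bullet> P x = c \<bullet> x" if "c \<in> B" for c x
  proof -
    have "c \<bullet> P x = (\<Sum>b\<in>B. (b \<bullet> x) * (c \<bullet> b))"
      by (simp add: P_def inner_sum_right)
    also have "\<dots> = (\<Sum>b\<in>B. if b = c then c \<bullet> x else 0)"
      using B(2,3) that
      by (intro sum.cong) (auto simp: pairwise_def orthogonal_def norm_eq_1)
    finally show ?thesis
      using that fin by simp
  qed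
  have "x - P x \<in> B\<^sup>\<bottom>" for x
    by (simp add: orthogonal_comp_def orthogonal_def inner_diff_right PB)
  then have perp: "x - P x \<in> W\<^sup>\<bottom>" for x
    using orthogonal_comp_span[of B] B(5) by simp
  have zero: "y = 0" if "y \<in> W" "y \<in> W\<^sup>\<bottom>" for y
    using orthogonal_Int_0[OF assms] that by blast
  show thesis
  proof
    show "P x = x" if "x \<in> W" for x
      using zero[of "x - P x"] perp PW that subspace_diff[OF assms] by force
    show "P x = 0 \<longleftrightarrow> x \<in> W\<^sup>\<bottom>" for x
      using zero[of "P x"] perp[of x] PW[of x] subspace_diff[OF subspace_orthogonal_comp, of x W "x - P x"]
      by force
  qed (fact lin PW)+
qed

lemma blinfun_linear: "linear (blinfun_apply f)"
  by (rule bounded_linear.linear) (rule blinfun.bounded_linear_right)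

text \<open>Transversality is stated dually: at points of the preimage, only 0 in
  \<open>W\<^sup>\<bottom>\<close> is orthogonal to the range of the derivative. Equivalently, the
  adjoint of the derivative is injective on \<open>W\<^sup>\<bottom>\<close>, so the codimension of
  \<open>W\<close> is preserved.\<close>

lemma C1_submanifold_transversal_preimage:
  fixes f :: "'a::euclidean_space \<Rightarrow> 'b::euclidean_space"
  assumes X: "open X" and W: "subspace W"
    and der: "\<And>x. x \<in> X \<Longrightarrow> (f has_derivative blinfun_apply (f' x)) (at x)"
    and cont: "continuous_on X f'"
    and transversal: "\<And>x r. x \<in> X \<Longrightarrow> f x \<in> W \<Longrightarrow> r \<in> W\<^sup>\<bottom> \<Longrightarrow>
       (\<And>v. r \<bullet> blinfun_apply (f' x) v = 0) \<Longrightarrow> r = 0"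
  shows "C1_submanifold X (DIM('a) - dim (W\<^sup>\<bottom>)) {x \<in> X. f x \<in> W}"
  unfolding C1_submanifold_def
proof (intro conjI ballI)
  fix p assume "p \<in> {x \<in> X. f x \<in> W}"
  then have p: "p \<in> X" "f p \<in> W" by auto
  define D where "D = blinfun_apply (f' p)"
  define A where "A = adjoint D"
  define R where "R = W\<^sup>\<bottom>"
  \<comment> \<open>\<open>L\<close> is the tangent space at \<open>p\<close>: \<open>v\<close> is
    orthogonal to the image of \<open>R\<close> under \<open>A\<close> iff \<open>D v\<close> is
    orthogonal to \<open>R\<close>, that is, iff \<open>D v\<close> lies in
    \<open>W\<close>.\<close>
  define L where "L = (A ` R)\<^sup>\<bottom>"
  have D: "linear D" and A: "linear A"
    by (auto simp: D_def A_def blinfun_linear intro!: adjoint_linear)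
  have R: "subspace R" and L: "subspace L" and AR: "subspace (A ` R)"
    by (auto simp: R_def L_def subspace_orthogonal_comp linear_subspace_image A)
  have A_zero: "r = 0" if "r \<in> R" "A r = 0" for r
    using transversal[OF p, of r] that adjoint_works[OF D, of _ r]
    by (simp add: A_def D_def R_def inner_commute)
  obtain P where P: "linear P" "\<And>x. P x \<in> R" "\<And>x. P x = 0 \<longleftrightarrow> x \<in> R\<^sup>\<bottom>"
    using orthogonal_projection_exists[OF R] by metis
  have P0: "P x = 0 \<longleftrightarrow> x \<in> W" for x
    by (simp add: P(3) R_def orthogonal_comp_self W)
  obtain Q where Q: "linear Q" "\<And>x. Q x \<in> L" "\<And>x. x \<in> L \<Longrightarrow> Q x = x"
    using orthogonal_projection_exists[OF L] by metis
  have AL: "v = 0" if "v \<in> A ` R" "v \<in> L" for v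
    using orthogonal_Int_0[OF AR] that unfolding L_def by blast
  have DL: "D v \<in> W \<Longrightarrow> v \<in> L" for v
    unfolding L_def orthogonal_comp_def
    by (auto simp: orthogonal_def A_def R_def orthogonal_comp_def inner_commute adjoint_clauses[OF D])
  text \<open>The straightening map: its second summand lies in \<open>L\<close>, its first one in \<open>A ` R\<close>, the orthogonal
    complement of \<open>L\<close>, where it vanishes exactly on the preimage of \<open>W\<close>.  Taking the adjoint \<open>A\<close> spares
    the choice of an isomorphism between the kernel of the derivative and a fixed subspace.\<close>
  define AP where "AP = Blinfun (\<lambda>y. A (P y))"
  have AP: "blinfun_apply AP = (\<lambda>y. A (P y))"
    unfolding AP_def
    using linear_compose[OF P(1) A]
    by (intro bounded_linear_Blinfun_apply) (simp add: linear_conv_bounded_linear o_def)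
  define QB where "QB = Blinfun Q"
  have QB: "blinfun_apply QB = Q"
    unfolding QB_def
    using Q(1) by (intro bounded_linear_Blinfun_apply) (simp add: linear_conv_bounded_linear)
  define \<phi> where "\<phi> x = AP (f x) + QB x" for x
  define \<phi>' where "\<phi>' x = (AP o\<^sub>L f' x) + QB" for x
  have der\<phi>: "(\<phi> has_derivative blinfun_apply (\<phi>' x)) (at x)" if "x \<in> X" for x
    unfolding \<phi>_def \<phi>'_def
    by (auto intro!: derivative_eq_intros der[OF that] simp: blinfun.add_left)
  have cont\<phi>: "continuous_on X \<phi>'"
    unfolding \<phi>'_def by (intro continuous_intros cont)
  have zero: "a = 0 \<and> b = 0" if "a \<in> A ` R" "b \<in> L" "a + b = 0" for a b
    using AL[of b] that subspace_neg[OF AR] by (metis add.right_neutral eq_neg_iff_add_eq_0 minus_minus)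
  \<comment> \<open>The two summands of the derivative lie in complementary subspaces, so both
    vanish. The first gives \<open>D v \<in> W\<close>, hence \<open>v \<in> L\<close>; the second
    then gives \<open>v = Q v = 0\<close>.\<close>
  have "v = 0" if "blinfun_apply (\<phi>' p) v = 0" for v
  proof -
    have "A (P (D v)) + Q v = 0"
      using that by (simp add: \<phi>'_def blinfun.add_left AP QB D_def)
    then have "A (P (D v)) = 0" "Q v = 0"
      using zero[of "A (P (D v))" "Q v"] P(2) Q(2) by auto
    then show ?thesis
      using A_zero P(2) P0 DL Q(3) by metis
  qed
  then have "inj (blinfun_apply (\<phi>' p))"
    by (simp add: linear_injective_0 blinfun_linear)
  then obtain U V where U: "p \<in> U" "U \<subseteq> X" "C1_diffeomorphism U V \<phi>"
    using C1_diffeomorphism_locally[OF X p(1) der\<phi> cont\<phi>] by metis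
  \<comment> \<open>As \<open>Q x \<in> L\<close>, only the first summand decides; it lies in the
    image of \<open>R\<close> under \<open>A\<close>, which meets \<open>L\<close> only in
    0.\<close>
  have mem: "\<phi> x \<in> L \<longleftrightarrow> f x \<in> W" for x
  proof -
    have "\<phi> x \<in> L \<longleftrightarrow> A (P (f x)) \<in> L"
      using Q(2)[of x] subspace_add[OF L] subspace_diff[OF L]
      by (metis (no_types) AP QB \<phi>_def add_diff_cancel_right')
    also have "\<dots> \<longleftrightarrow> A (P (f x)) = 0"
      using AL P(2) subspace_0[OF L] by auto
    also have "\<dots> \<longleftrightarrow> f x \<in> W"
      using A_zero P(2) P0 linear_0[OF A] by metis
    finally show ?thesis .
  qed
  have "\<phi> ` U = V"
    using U(3) by (auto simp: C1_diffeomorphism_def homeomorphism_def)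
  then have im: "\<phi> ` (U \<inter> {x \<in> X. f x \<in> W}) = V \<inter> L"
    using U(2) mem by blast
  have "inj_on A (span R)"
    using A_zero R by (simp add: linear_inj_on_iff_eq_0[OF A] span_eq_iff[THEN iffD2])
  then have "dim (A ` R) = dim R"
    by (rule dim_image_eq[OF A])
  moreover have "dim L + dim (A ` R) = DIM('a)"
    using dim_subspace_orthogonal_to_vectors[OF AR subspace_UNIV]
    by (simp add: L_def orthogonal_comp_def)
  ultimately have "dim L = DIM('a) - dim (W\<^sup>\<bottom>)"
    by (simp add: R_def)
  then show "\<exists>U V L. \<exists>\<phi> :: 'a \<Rightarrow> 'a. p \<in> U \<and> U \<subseteq> X \<and> C1_diffeomorphism U V \<phi> \<and>
        subspace L \<and> dim L = DIM('a) - dim (W\<^sup>\<bottom>) \<and> \<phi> ` (U \<inter> {x \<in> X. f x \<in> W}) = V \<inter> L"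
    using U L im by blast
qed auto


section \<open>Symmetry of second derivatives\<close>

text \<open>The mean value theorem is applied twice, first along \<open>u\<close> to a difference of
  values of \<open>F\<close>, then along \<open>v\<close> to \<open>u \<bullet> G\<close>.\<close>

lemma second_difference_mean_value:
  fixes F :: "'a::real_inner \<Rightarrow> real"
  assumes "0 \<le> t"
    and F: "\<And>x. x \<in> X \<Longrightarrow> GDERIV F x :> G x"
    and G: "\<And>x. x \<in> X \<Longrightarrow> (G has_derivative G' x) (at x)"
    and X: "\<And>r s. r \<in> {0..t} \<Longrightarrow> s \<in> {0..t} \<Longrightarrow> x + r *\<^sub>R u + s *\<^sub>R v \<in> X"
  obtains r s where "r \<in> {0..t}" "s \<in> {0..t}"
    "F (x + t *\<^sub>R u + t *\<^sub>R v) - F (x + t *\<^sub>R u) - F (x + t *\<^sub>R v) + F x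
       = t * t * (u \<bullet> G' (x + r *\<^sub>R u + s *\<^sub>R v) v)"
proof -
  have F': "(F has_derivative (\<lambda>h. h \<bullet> G y)) (at y)" if "y \<in> X" for y
    using F[OF that] by (simp add: gderiv_def)
  \<comment> \<open>The second difference of \<open>F\<close> is exactly
    \<open>a t - a 0\<close>.\<close>
  define a where "a r = F (x + r *\<^sub>R u + t *\<^sub>R v) - F (x + r *\<^sub>R u)" for r
  have "\<exists>r\<in>{0..t}. a t - a 0 =
      (\<lambda>h. (h *\<^sub>R u) \<bullet> G (x + r *\<^sub>R u + t *\<^sub>R v) - (h *\<^sub>R u) \<bullet> G (x + r *\<^sub>R u)) (t - 0)"
  proof (rule mvt_very_simple[OF \<open>0 \<le> t\<close>])
    fix r assume r: "0 \<le> r" "r \<le> t"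
    have "x + r *\<^sub>R u + t *\<^sub>R v \<in> X" "x + r *\<^sub>R u \<in> X"
      using X[of r t] X[of r 0] r \<open>0 \<le> t\<close> by auto
    note F1 = F'[OF this(1)] and F2 = F'[OF this(2)]
    have "((\<lambda>r. F (x + r *\<^sub>R u + t *\<^sub>R v)) has_derivative
        (\<lambda>h. (h *\<^sub>R u) \<bullet> G (x + r *\<^sub>R u + t *\<^sub>R v))) (at r within {0..t})"
      by (rule has_derivative_compose[where f = "\<lambda>r. x + r *\<^sub>R u + t *\<^sub>R v", OF _ F1])
        (auto intro!: derivative_eq_intros)
    moreover have "((\<lambda>r. F (x + r *\<^sub>R u)) has_derivative
        (\<lambda>h. (h *\<^sub>R u) \<bullet> G (x + r *\<^sub>R u))) (at r within {0..t})"
      by (rule has_derivative_compose[where f = "\<lambda>r. x + r *\<^sub>R u", OF _ F2])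
        (auto intro!: derivative_eq_intros)
    ultimately show "(a has_derivative (\<lambda>h. (h *\<^sub>R u) \<bullet> G (x + r *\<^sub>R u + t *\<^sub>R v)
        - (h *\<^sub>R u) \<bullet> G (x + r *\<^sub>R u))) (at r within {0..t})"
      unfolding a_def by (rule has_derivative_diff)
  qed
  then obtain r where r: "r \<in> {0..t}"
    "a t - a 0 = t * (u \<bullet> G (x + r *\<^sub>R u + t *\<^sub>R v) - u \<bullet> G (x + r *\<^sub>R u))"
    by (auto simp: right_diff_distrib)
  define b where "b s = u \<bullet> G (x + r *\<^sub>R u + s *\<^sub>R v)" for s
  have "\<exists>s\<in>{0..t}. b t - b 0 = (\<lambda>h. u \<bullet> G' (x + r *\<^sub>R u + s *\<^sub>R v) (h *\<^sub>R v)) (t - 0)"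
  proof (rule mvt_very_simple[OF \<open>0 \<le> t\<close>])
    fix s assume s: "0 \<le> s" "s \<le> t"
    have "x + r *\<^sub>R u + s *\<^sub>R v \<in> X"
      using X[of r s] r s by auto
    note G1 = G[OF this]
    have "((\<lambda>s. G (x + r *\<^sub>R u + s *\<^sub>R v)) has_derivative
        (\<lambda>h. G' (x + r *\<^sub>R u + s *\<^sub>R v) (h *\<^sub>R v))) (at s within {0..t})"
      by (rule has_derivative_compose[where f = "\<lambda>s. x + r *\<^sub>R u + s *\<^sub>R v", OF _ G1])
        (auto intro!: derivative_eq_intros)
    then show "(b has_derivative (\<lambda>h. u \<bullet> G' (x + r *\<^sub>R u + s *\<^sub>R v) (h *\<^sub>R v))) (at s within {0..t})"
      unfolding b_def by (rule has_derivative_inner_right)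
  qed
  then obtain s where s: "s \<in> {0..t}" "b t - b 0 = u \<bullet> G' (x + r *\<^sub>R u + s *\<^sub>R v) (t *\<^sub>R v)"
    by auto
  have "x + r *\<^sub>R u + s *\<^sub>R v \<in> X"
    using X r s by auto
  then have "G' (x + r *\<^sub>R u + s *\<^sub>R v) (t *\<^sub>R v) = t *\<^sub>R G' (x + r *\<^sub>R u + s *\<^sub>R v) v"
    using G has_derivative_linear linear_cmul by blast
  then show thesis
    using that[OF r(1) s(1)] r(2) s(2) by (simp add: a_def b_def)
qed

text \<open>Schwarz's theorem without coordinates: one second difference equals \<open>t * t\<close>
  times either mixed derivative, each taken at some point near \<open>x\<close>; continuity of
  \<open>G'\<close> carries the equality to \<open>x\<close>.\<close>

lemma second_derivative_symmetric:
  fixes F :: "'a::real_inner \<Rightarrow> real" and G' :: "'a \<Rightarrow> 'a \<Rightarrow>\<^sub>L 'a"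
  assumes "open X" "x \<in> X"
    and F: "\<And>x. x \<in> X \<Longrightarrow> GDERIV F x :> G x"
    and G: "\<And>x. x \<in> X \<Longrightarrow> (G has_derivative blinfun_apply (G' x)) (at x)"
    and cont: "continuous_on X G'"
  shows "u \<bullet> blinfun_apply (G' x) v = v \<bullet> blinfun_apply (G' x) u"
proof -
  text \<open>The mixed second difference of \<open>F\<close> is symmetric in \<open>u\<close> and \<open>v\<close>.\<close>
  have close: "\<exists>t>0. \<forall>r s. r \<in> {0..t} \<longrightarrow> s \<in> {0..t} \<longrightarrow> x + r *\<^sub>R u + s *\<^sub>R v \<in> ball x d"
    if "d > 0" for d
  proof -
    \<comment> \<open>The summand 1 keeps the denominator positive when \<open>u = v = 0\<close>;
      the factor 2 makes the bound by \<open>d\<close> strict.\<close>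
    define t where "t = d / (2 * (norm u + norm v + 1))"
    have den: "norm u + norm v + 1 > 0"
      by (simp add: add_nonneg_pos)
    then have t: "t > 0"
      using that by (simp add: t_def)
    have "t * (norm u + norm v + 1) = d / 2"
      unfolding t_def using den by (metis (no_types) less_irrefl nonzero_divide_eq_eq
        divide_divide_eq_left mult.commute)
    then have t_lt: "t * (norm u + norm v + 1) < d"
      using that by simp
    have "x + r *\<^sub>R u + s *\<^sub>R v \<in> ball x d" if "r \<in> {0..t}" "s \<in> {0..t}" for r s
    proof -
      have "norm (r *\<^sub>R u + s *\<^sub>R v) \<le> r * norm u + s * norm v"
        using that norm_triangle_ineq[of "r *\<^sub>R u" "s *\<^sub>R v"] by simp
      also have "\<dots> \<le> t * norm u + t * norm v"
        using that by (intro add_mono mult_right_mono) auto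
      also have "\<dots> < d"
        using t t_lt by (simp add: algebra_simps)
      finally show ?thesis
        by (simp add: dist_norm norm_minus_commute add.assoc, simp add: add.commute)
    qed
    with t show ?thesis by blast
  qed
  define a where "a y = u \<bullet> blinfun_apply (G' y) v" for y
  define b where "b y = v \<bullet> blinfun_apply (G' y) u" for y
  have ab: "continuous_on X a" "continuous_on X b"
    unfolding a_def b_def by (intro continuous_intros cont)+
  have "\<bar>a x - b x\<bar> \<le> e" if "e > 0" for e :: real
  proof -
    obtain d1 where d1: "d1 > 0" "\<And>y. y \<in> X \<Longrightarrow> dist y x < d1 \<Longrightarrow> dist (a y) (a x) < e/2"
      using ab(1) \<open>x \<in> X\<close> \<open>e > 0\<close> unfolding continuous_on_iff by (meson half_gt_zero)
    obtain d2 where d2: "d2 > 0" "\<And>y. y \<in> X \<Longrightarrow> dist y x < d2 \<Longrightarrow> dist (b y) (b x) < e/2"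
      using ab(2) \<open>x \<in> X\<close> \<open>e > 0\<close> unfolding continuous_on_iff by (meson half_gt_zero)
    obtain d3 where d3: "d3 > 0" "ball x d3 \<subseteq> X"
      using \<open>open X\<close> \<open>x \<in> X\<close> open_contains_ball by blast
    \<comment> \<open>\<open>d1\<close> and \<open>d2\<close> control the variation of
      \<open>a\<close> and \<open>b\<close>; \<open>d3\<close> keeps the whole parallelogram inside
      \<open>X\<close>.\<close>
    define d where "d = min d1 (min d2 d3)"
    have "d > 0"
      using d1 d2 d3 by (simp add: d_def)
    then obtain t where t: "t > 0"
      "\<And>r s. r \<in> {0..t} \<Longrightarrow> s \<in> {0..t} \<Longrightarrow> x + r *\<^sub>R u + s *\<^sub>R v \<in> ball x d"
      using close by blast
    have X: "x + r *\<^sub>R u + s *\<^sub>R v \<in> X" if "r \<in> {0..t}" "s \<in> {0..t}" for r s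
      using t(2)[OF that] d3 by (auto simp: d_def)
    have X': "x + r *\<^sub>R v + s *\<^sub>R u \<in> X" if "r \<in> {0..t}" "s \<in> {0..t}" for r s
      using X[OF that(2,1)] by (simp add: algebra_simps)
    obtain r s where rs: "r \<in> {0..t}" "s \<in> {0..t}"
      "F (x + t *\<^sub>R u + t *\<^sub>R v) - F (x + t *\<^sub>R u) - F (x + t *\<^sub>R v) + F x
        = t * t * a (x + r *\<^sub>R u + s *\<^sub>R v)"
      unfolding a_def by (rule second_difference_mean_value[OF less_imp_le[OF t(1)] F G X])
    obtain r' s' where rs': "r' \<in> {0..t}" "s' \<in> {0..t}"
      "F (x + t *\<^sub>R v + t *\<^sub>R u) - F (x + t *\<^sub>R v) - F (x + t *\<^sub>R u) + F x
        = t * t * b (x + r' *\<^sub>R v + s' *\<^sub>R u)"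
      unfolding b_def by (rule second_difference_mean_value[OF less_imp_le[OF t(1)] F G X'])
    have swap: "x + r' *\<^sub>R v + s' *\<^sub>R u = x + s' *\<^sub>R u + r' *\<^sub>R v" for r' s'
      by (simp add: algebra_simps)
    have "t * t * a (x + r *\<^sub>R u + s *\<^sub>R v) = t * t * b (x + s' *\<^sub>R u + r' *\<^sub>R v)"
      using rs(3) rs'(3) unfolding swap[of r' s'] swap[of t t] by linarith
    then have eq: "a (x + r *\<^sub>R u + s *\<^sub>R v) = b (x + s' *\<^sub>R u + r' *\<^sub>R v)"
      using t(1) by simp
    have "dist (a (x + r *\<^sub>R u + s *\<^sub>R v)) (a x) < e/2"
      by (rule d1(2)[OF X[OF rs(1,2)]]) (use t(2)[OF rs(1,2)] in \<open>simp add: d_def dist_commute\<close>)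
    moreover have "dist (b (x + s' *\<^sub>R u + r' *\<^sub>R v)) (b x) < e/2"
      by (rule d2(2)[OF X[OF rs'(2,1)]]) (use t(2)[OF rs'(2,1)] in \<open>simp add: d_def dist_commute\<close>)
    ultimately show ?thesis
      using eq unfolding dist_real_def by linarith
  qed
  then have "\<bar>a x - b x\<bar> \<le> 0"
    using field_le_epsilon[of "\<bar>a x - b x\<bar>" 0] by simp
  then show ?thesis
    by (simp add: a_def b_def)
qed


section \<open>Thermodynamic equilibria\<close>

lemma locally_lipschitz_imp_continuous_on:
  "locally_lipschitz X f \<Longrightarrow> continuous_on X f"
  unfolding locally_lipschitz_def by (drule local_lipschitz_continuous_on[of _ _ _ 0]) auto

lemma closedin_thermodynamic_equilibria:
  assumes "continuous_on X (grad H)" "continuous_on X (grad S)"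
  shows "closedin (top_of_set X) (thermodynamic_equilibria X H S N J)"
proof -
  have "continuous_on X (bracket (J k) S H)" for k
    unfolding bracket_def
    by (intro continuous_intros assms linear_continuous_on_compose[OF assms(1)]) simp
  then have "closedin (top_of_set X) {x \<in> X. bracket (J k) S H x = 0}" for k
    by (rule continuous_closedin_preimage_constant)
  \<comment> \<open>Intersecting with \<open>X\<close> covers \<open>N = 0\<close>, where the
    intersection over the empty index set is the whole space.\<close>
  then have "closedin (top_of_set X) (X \<inter> (\<Inter>k\<in>{1..N}. {x \<in> X. bracket (J k) S H x = 0}))"
    by (cases "{1..N} = {}") (auto intro!: closedin_Int closedin_Inter)
  moreover have "X \<inter> (\<Inter>k\<in>{1..N}. {x \<in> X. bracket (J k) S H x = 0})
      = thermodynamic_equilibria X H S N J"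
    by (auto simp: thermodynamic_equilibria_def)
  ultimately show ?thesis by simp
qed

text \<open>\<open>S\<close> is linear only on \<open>X\<close>; openness of \<open>X\<close> makes
  the two functions agree near \<open>x\<close>, so their derivatives coincide.\<close>

lemma grad_inner:
  assumes "open X" "x \<in> X" "\<And>x. x \<in> X \<Longrightarrow> S x = e \<bullet> x"
  shows "grad S x = e"
proof -
  have "((\<bullet>) e has_derivative (\<bullet>) e) (at x)"
    by (intro derivative_eq_intros) auto
  then have "(S has_derivative (\<bullet>) e) (at x)"
    by (rule has_derivative_transform_within_open[OF _ assms(1,2)]) (simp add: assms(3))
  then have "frechet_derivative S (at x) = (\<bullet>) e"
    by (rule frechet_derivative_at[symmetric])
  then show ?thesis
    by (simp add: grad_def vec_eq_iff inner_axis)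
qed

text \<open>This moves \<open>J k\<close> onto \<open>e\<close>: the bracket becomes
  \<open>- ((J k *v e) \<bullet> grad H x)\<close>, so its vanishing is orthogonality to
  \<open>J k *v e\<close>.\<close>

lemma skew_symmetric_inner:
  assumes "skew_symmetric A"
  shows "x \<bullet> (A *v y) = - ((A *v x) \<bullet> y)"
proof -
  have "x \<bullet> (A *v y) = (transpose A *v x) \<bullet> y"
    by (simp add: dot_lmul_matrix)
  then show ?thesis
    using assms by (simp add: skew_symmetric_def matrix_vector_mult_def vec_eq_iff inner_vec_def sum_negf)
qed

text \<open>The entries of \<open>append_row A v *v r\<close> are those of \<open>A *v r\<close>
  followed by \<open>v \<bullet> r\<close>, and full column rank means trivial kernel.\<close>

lemma append_row_full_rank_kernel:
  fixes A :: "real^'n^'n"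
  assumes "rank (append_row A v) = CARD('n)" "A *v r = 0" "v \<bullet> r = 0"
  shows "r = 0"
proof -
  have "(append_row A v *v r) $ i = 0" for i
    using assms(2,3)
    by (cases i) (auto simp: append_row_def matrix_vector_mult_def inner_vec_def vec_eq_iff)
  then have "append_row A v *v r = 0"
    by (simp add: vec_eq_iff)
  then show ?thesis
    using assms(1) matrix_nonfull_linear_equations_eq by blast
qed

text \<open>\<open>C1_on X (grad H)\<close> ensures that the Hessian in the rank condition exists
  and is continuous. The dimension is attached to the nonempty case because the empty set is a
  submanifold of every dimension.\<close>

theorem lemma2p4:
  fixes X :: "(real^'n) set"
    and J\<^sub>0 :: "real^'n \<Rightarrow> real^'n^'n"
    and H S :: "real^'n \<Rightarrow> real"
    and N :: nat
    and J :: "nat \<Rightarrow> real^'n^'n"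
    and \<gamma> :: "nat \<Rightarrow> (real^'n) \<times> (real^'n) \<Rightarrow> real"
    and g :: "(real^'n) \<times> (real^'n) \<Rightarrow> real^'m^'n"
  assumes "riphs X J\<^sub>0 H S N J \<gamma> g"
  shows "closedin (top_of_set X) (thermodynamic_equilibria X H S N J) \<and>
    (\<forall>e :: real^'n.
       C1_on X (grad H) \<and>
       (\<forall>x\<in>X. S x = e \<bullet> x) \<and>
       (\<forall>x\<in>X. rank (append_row (hessian H x) (grad H x)) = CARD('n))
       \<longrightarrow>
       (\<exists>d. C1_submanifold X d (thermodynamic_equilibria X H S N J)) \<and>
       (thermodynamic_equilibria X H S N J = {} \<longleftrightarrow>
          grad H ` X \<inter> (\<Inter>k\<in>{1..N}. {J k *v e}\<^sup>\<bottom>) = {}) \<and>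
       (thermodynamic_equilibria X H S N J \<noteq> {} \<longrightarrow>
          C1_submanifold X (CARD('n) - rank_of_columns N (\<lambda>k. J k *v e))
            (thermodynamic_equilibria X H S N J)))"
proof (intro conjI allI impI; (elim conjE)?)
  let ?T = "thermodynamic_equilibria X H S N J"
  have X: "open X" and H: "\<And>x. x \<in> X \<Longrightarrow> H differentiable (at x)"
    and skew: "\<And>k. k \<in> {1..N} \<Longrightarrow> skew_symmetric (J k)"
    using assms by (auto simp: riphs_def)
  show "closedin (top_of_set X) ?T"
    using assms
    by (intro closedin_thermodynamic_equilibria locally_lipschitz_imp_continuous_on)
      (simp_all add: riphs_def)
  fix e :: "real^'n"
  assume C1: "C1_on X (grad H)" and S: "\<forall>x\<in>X. S x = e \<bullet> x"
    and rank: "\<forall>x\<in>X. rank (append_row (hessian H x) (grad H x)) = CARD('n)"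
  define B where "B = (\<lambda>k. J k *v e) ` {1..N}"
  have B: "(\<Inter>k\<in>{1..N}. {J k *v e}\<^sup>\<bottom>) = B\<^sup>\<bottom>"
    by (auto simp: B_def orthogonal_comp_def)
  have T: "?T = {x \<in> X. grad H x \<in> B\<^sup>\<bottom>}"
    using S skew
    by (auto simp: thermodynamic_equilibria_def bracket_def grad_inner[OF X] skew_symmetric_inner
        B_def orthogonal_comp_def orthogonal_def)
  show "?T = {} \<longleftrightarrow> grad H ` X \<inter> (\<Inter>k\<in>{1..N}. {J k *v e}\<^sup>\<bottom>) = {}"
    unfolding B T by blast
  obtain G' where G': "\<And>x. x \<in> X \<Longrightarrow> (grad H has_derivative blinfun_apply (G' x)) (at x)"
    and cont: "continuous_on X G'"
    using C1 unfolding C1_on_def by blast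
  \<comment> \<open>The derivative provided by \<open>C1_on\<close> and the Jacobian matrix defining
    \<open>hessian\<close> agree by uniqueness of derivatives.\<close>
  have hess: "blinfun_apply (G' x) v = hessian H x *v v" if "x \<in> X" for x v
  proof -
    have "(grad H has_derivative (\<lambda>h. hessian H x *v h)) (at x)"
      using G'[OF that] unfolding hessian_def jacobian_works[symmetric] by (rule differentiableI)
    then show ?thesis
      using G'[OF that] has_derivative_unique by metis
  qed
  have "C1_submanifold X (DIM(real^'n) - dim (B\<^sup>\<bottom>\<^sup>\<bottom>)) {x \<in> X. grad H x \<in> B\<^sup>\<bottom>}"
  proof (rule C1_submanifold_transversal_preimage[OF X subspace_orthogonal_comp G' cont])
    fix x r assume x: "x \<in> X" "grad H x \<in> B\<^sup>\<bottom>" and r: "r \<in> B\<^sup>\<bottom>\<^sup>\<bottom>"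
      and van: "\<And>v. r \<bullet> blinfun_apply (G' x) v = 0"
    have "v \<bullet> blinfun_apply (G' x) r = 0" for v
      using second_derivative_symmetric[OF X x(1) grad_GDERIV[OF H] G' cont, of v r] van by simp
    \<comment> \<open>The choice \<open>v = hessian H x *v r\<close> makes its squared norm
      vanish.\<close>
    then have "hessian H x *v r = 0"
      using hess[OF x(1)] by (metis inner_eq_zero_iff)
    moreover have "grad H x \<bullet> r = 0"
      using x(2) r unfolding orthogonal_comp_def[of "B\<^sup>\<bottom>"] orthogonal_def by blast
    ultimately show "r = 0"
      using append_row_full_rank_kernel rank x(1) by blast
  qed
  \<comment> \<open>The double complement of \<open>B\<close> is \<open>span B\<close>, whose
    dimension is the rank of the matrix with columns \<open>J k *v e\<close>.\<close>
  then have sub: "C1_submanifold X (CARD('n) - rank_of_columns N (\<lambda>k. J k *v e)) ?T"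
    unfolding T by (simp add: orthogonal_comp_comp rank_of_columns_def B_def)
  show "C1_submanifold X (CARD('n) - rank_of_columns N (\<lambda>k. J k *v e)) ?T"
    by (rule sub)
  show "\<exists>d. C1_submanifold X d ?T"
    using sub by blast
qed

end
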